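(* Let $n\le m$, $C\in\mathbb{R}^{m\times n}$, $\varepsilon>0$, and consider the linear model $\mathbf{y}=C\mathbf{x}^*+\boldsymbol{\nu}$, where $\mathbf{y}\in\mathbb{R}^m$ is the vector of measurements, $\mathbf{x}^*\in\mathbb{R}^n$ is the unknown actual internal state, and $\boldsymbol{\nu}\in\mathbb{R}^m$ is a model error with $\|\boldsymbol{\nu}\|\le\varepsilon$. Consider any partial measurement $\mathbf{y}_1\in\mathbb{R}^{m_1}$, $m_1>n$, consisting of a subset of the entries of $\mathbf{y}$, so that $$\mathbf{y}_1=C_1\mathbf{x}^*+\boldsymbol{\nu}_1,$$ where $C_1\in\mathbb{R}^{m_1\times n}$ is the matrix of the corresponding rows of $C$ and $\boldsymbol{\nu}_1\in\mathbb{R}^{m_1}$ is the vector of the corresponding entries of $\boldsymbol{\nu}$. Let $\sigma_1$ be the minimal singular value of $C_1$. Then the least-square estimator $$\hat{\mathbf{x}}\in\operatorname{arg\,min}_{\mathbf{x}\in\mathbb{R}^n}\ \tfrac12\|\mathbf{y}_1-C_1\mathbf{x}\|^2$$ satisfies $$\|\hat{\mathbf{x}}-\mathbf{x}^*\|\le\frac{2}{\sigma_1}\,\varepsilon .$$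
   Context: $\|\cdot\|$ is the Euclidean norm. The right-hand side is read as $+\infty$ when $\sigma_1=0$. *)

theory Defs
  imports "HOL-Analysis.Analysis"
begin

definition eigenvalues :: "real^'n^'n \<Rightarrow> real set" where
  "eigenvalues A = {l. \<exists>v. v \<noteq> 0 \<and> A *v v = l *\<^sub>R v}"

(* Following the convention that a matrix with n columns has n singular values, which agrees
   with every other convention whenever there are at least as many rows as columns. A wide
   matrix therefore also has 0 as a singular value. The set forgets multiplicities. *)
definition singular_values :: "real^'n^'m \<Rightarrow> real set" where
  "singular_values A = sqrt ` eigenvalues (transpose A ** A)"

(* The set is finite, and nonempty by the spectral theorem for the symmetric Gram matrix,
   so Min is its least element. *)
definition min_singular_value :: "real^'n^'m \<Rightarrow> real" where
  "min_singular_value A = Min (singular_values A)"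

end

theory Submission
  imports Defs
begin

text \<open>
  Write \<open>A\<close> for the selected rows of \<open>C\<close>. Both \<open>A x*\<close> and \<open>A xhat\<close> lie
  within \<open>\<epsilon>\<close> of the partial measurement: the first because dropping entries of the model
  error does not increase its norm, the second because the least-squares residual is no larger
  than the residual of \<open>x*\<close>. So \<open>A (xhat - x*)\<close> has norm at most
  \<open>2 \<epsilon>\<close>, and it remains to invert \<open>A\<close> quantitatively:
  \<open>\<sigma> \<parallel>v\<parallel> \<le> \<parallel>A v\<parallel>\<close> for the least singular value
  \<open>\<sigma>\<close>, which is \<open>min_singular_value_bound\<close>.

  That bound is the variational characterisation of the least eigenvalue of the Gram matrix
  \<open>A\<^sup>T A\<close>. By compactness, \<open>\<parallel>A v\<parallel>\<^sup>2\<close> has a minimum \<open>\<mu>\<close> on the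
  unit sphere, and a first-order argument shows that \<open>\<mu>\<close> is an eigenvalue
  (\<open>gram_eigenvalue_minimising\<close>). Since \<open>\<sigma>\<close> is a \<open>Min\<close>, comparing it with
  \<open>\<surd>\<mu>\<close> also requires the spectrum to be finite; this follows from the orthogonality
  of eigenvectors that belong to different eigenvalues (\<open>finite_eigenvalues_symmetric\<close>).
\<close>

lemma inner_gram: "w \<bullet> ((transpose A ** A) *v v) = (A *v w) \<bullet> (A *v v)"
  for A :: "real^'n^'m"
  by (metis dot_lmul_matrix inner_commute matrix_vector_mul_assoc transpose_matrix_vector)

lemma norm_add_scaleR_squared:
  "(norm (a + t *\<^sub>R b))\<^sup>2 = (norm a)\<^sup>2 + 2 * t * (b \<bullet> a) + t\<^sup>2 * (norm b)\<^sup>2"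
  unfolding power2_norm_eq_inner
  by (simp add: inner_add_left inner_add_right inner_commute algebra_simps power2_eq_square)

text \<open>
  One eigenvector chosen per eigenvalue gives an injective family of nonzero, pairwise
  orthogonal, hence linearly independent vectors; in finite dimension such a family is finite.
\<close>

lemma finite_eigenvalues_symmetric:
  fixes G :: "real^'n^'n"
  assumes sym: "\<And>v w. w \<bullet> (G *v v) = (G *v w) \<bullet> v"
  shows "finite (eigenvalues G)"
proof -
  define f where "f l = (SOME v. v \<noteq> 0 \<and> G *v v = l *\<^sub>R v)" for l
  have f: "f l \<noteq> 0 \<and> G *v f l = l *\<^sub>R f l" if "l \<in> eigenvalues G" for l
    unfolding f_def by (rule someI_ex) (use that in \<open>simp add: eigenvalues_def\<close>)
  have orth: "f l \<bullet> f k = 0" if "l \<in> eigenvalues G" "k \<in> eigenvalues G" "l \<noteq> k" for l k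
  proof -
    have "k * (f l \<bullet> f k) = l * (f l \<bullet> f k)"
      using sym[of "f l" "f k"] f[OF that(1)] f[OF that(2)] by simp
    then show ?thesis using that(3) by simp
  qed
  have "inj_on f (eigenvalues G)"
    by (rule inj_onI) (metis f inner_eq_zero_iff orth)
  moreover have "pairwise orthogonal (f ` eigenvalues G)"
    using orth by (auto simp: pairwise_def orthogonal_def)
  then have "independent (f ` eigenvalues G)"
    by (rule pairwise_orthogonal_independent) (use f in force)
  then have "finite (f ` eigenvalues G)"
    by (rule independent_imp_finite)
  ultimately show ?thesis by (simp add: finite_image_iff)
qed

text \<open>
  The eigenvalue is the minimum of \<open>\<parallel>A v\<parallel>\<^sup>2\<close> over the unit sphere. The form
  \<open>\<parallel>A v\<parallel>\<^sup>2 - \<mu> \<parallel>v\<parallel>\<^sup>2\<close> is then nonnegative and vanishes at a minimiser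
  \<open>u\<close>, so its gradient, which is twice \<open>(A\<^sup>T A - \<mu>) u\<close>, vanishes there as well.
\<close>

lemma gram_eigenvalue_minimising:
  fixes A :: "real^'n^'m"
  obtains \<mu> where "\<mu> \<in> eigenvalues (transpose A ** A)"
    and "\<And>v. \<mu> * (norm v)\<^sup>2 \<le> (norm (A *v v))\<^sup>2"
proof -
  have "continuous_on (sphere 0 1) (\<lambda>v. (norm (A *v v))\<^sup>2)"
    by (intro continuous_intros matrix_vector_mult_linear_continuous_on)
  moreover have "sphere (0 :: real^'n) 1 \<noteq> {}" by simp
  ultimately have "\<exists>u\<in>sphere 0 1. \<forall>v\<in>sphere 0 1. (norm (A *v u))\<^sup>2 \<le> (norm (A *v v))\<^sup>2"
    by (intro continuous_attains_inf compact_sphere)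
  then obtain u where u: "norm u = 1"
    and umin: "\<And>v. norm v = 1 \<Longrightarrow> (norm (A *v u))\<^sup>2 \<le> (norm (A *v v))\<^sup>2"
    by auto
  define \<mu> where "\<mu> = (norm (A *v u))\<^sup>2"
  have bound: "\<mu> * (norm v)\<^sup>2 \<le> (norm (A *v v))\<^sup>2" for v
  proof (cases "v = 0")
    case False
    have "\<mu> \<le> (norm (A *v ((1 / norm v) *\<^sub>R v)))\<^sup>2"
      unfolding \<mu>_def by (rule umin) (use False in simp)
    also have "\<dots> = (norm (A *v v))\<^sup>2 / (norm v)\<^sup>2"
      by (simp add: matrix_vector_mult_scaleR power_divide)
    finally show ?thesis using False by (simp add: field_simps)
  qed simp
  define r where "r = (transpose A ** A) *v u - \<mu> *\<^sub>R u"
  define q where "q = (norm (A *v r))\<^sup>2 - \<mu> * (norm r)\<^sup>2"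
  have r_inner: "r \<bullet> r = (A *v r) \<bullet> (A *v u) - \<mu> * (r \<bullet> u)"
  proof -
    have "r \<bullet> r = r \<bullet> ((transpose A ** A) *v u) - \<mu> * (r \<bullet> u)"
      by (subst (2) r_def) (simp add: inner_diff_right)
    then show ?thesis by (simp add: inner_gram)
  qed
  (* The value of the form at u + t r, where its constant term vanishes. *)
  have form: "0 \<le> 2 * t * (r \<bullet> r) + t\<^sup>2 * q" for t
  proof -
    have "(norm (A *v (u + t *\<^sub>R r)))\<^sup>2
        = \<mu> + 2 * t * ((A *v r) \<bullet> (A *v u)) + t\<^sup>2 * (norm (A *v r))\<^sup>2"
      by (simp add: \<mu>_def matrix_vector_right_distrib matrix_vector_mult_scaleR
          norm_add_scaleR_squared)
    moreover have "(norm (u + t *\<^sub>R r))\<^sup>2 = 1 + 2 * t * (r \<bullet> u) + t\<^sup>2 * (norm r)\<^sup>2"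
      using u by (simp add: norm_add_scaleR_squared)
    ultimately show ?thesis
      using bound[of "u + t *\<^sub>R r"] by (simp add: r_inner q_def algebra_simps)
  qed
  have "r = 0"
  proof (rule ccontr)
    assume "r \<noteq> 0"
    then have pos: "0 < r \<bullet> r" by simp
    (* This small negative t makes the linear term dominate the quadratic one. *)
    define t where "t = - (r \<bullet> r) / (\<bar>q\<bar> + 1)"
    have "t < 0" using pos by (simp add: t_def divide_neg_pos)
    have "t * (2 * (r \<bullet> r) + t * q) \<ge> 0"
      using form[of t] by (simp add: algebra_simps power2_eq_square)
    then have "2 * (r \<bullet> r) + t * q \<le> 0"
      using \<open>t < 0\<close> by (simp add: zero_le_mult_iff)
    moreover have "\<bar>t * q\<bar> \<le> r \<bullet> r"
    proof -
      have "\<bar>t * q\<bar> = (r \<bullet> r) * (\<bar>q\<bar> / (\<bar>q\<bar> + 1))"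
        by (simp add: t_def abs_mult)
      also have "\<dots> \<le> (r \<bullet> r) * 1"
        by (intro mult_left_mono) simp_all
      finally show ?thesis by simp
    qed
    ultimately show False using pos by linarith
  qed
  then have "\<mu> \<in> eigenvalues (transpose A ** A)"
    using u by (auto simp: eigenvalues_def r_def intro!: exI[of _ u])
  then show thesis using bound by (rule that)
qed

lemma finite_singular_values: "finite (singular_values A)"
  unfolding singular_values_def
  by (intro finite_imageI finite_eigenvalues_symmetric) (metis inner_commute inner_gram)

lemma singular_values_nonneg:
  assumes "s \<in> singular_values A"
  shows "0 \<le> s"
proof -
  obtain l v where s: "s = sqrt l" and v: "v \<noteq> 0" "(transpose A ** A) *v v = l *\<^sub>R v"
    using assms by (auto simp: singular_values_def eigenvalues_def)
  have "l * (v \<bullet> v) = (A *v v) \<bullet> (A *v v)"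
    using inner_gram[of v A v] v(2) by simp
  then have "0 \<le> l * (v \<bullet> v)" by simp
  moreover have "0 < v \<bullet> v" using v(1) by simp
  ultimately have "0 \<le> l" by (simp only: zero_le_mult_iff) linarith
  then show ?thesis using s by simp
qed

lemma min_singular_value_nonneg: "0 \<le> min_singular_value A"
proof -
  have "singular_values A \<noteq> {}"
    using gram_eigenvalue_minimising[of A] by (auto simp: singular_values_def)
  then show ?thesis
    unfolding min_singular_value_def
    by (intro singular_values_nonneg[of _ A] Min_in finite_singular_values)
qed

lemma min_singular_value_bound: "min_singular_value A * norm v \<le> norm (A *v v)"
proof -
  obtain \<mu> where \<mu>: "\<mu> \<in> eigenvalues (transpose A ** A)"
    and le: "\<mu> * (norm v)\<^sup>2 \<le> (norm (A *v v))\<^sup>2"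
    using gram_eigenvalue_minimising[of A] by metis
  have "min_singular_value A \<le> sqrt \<mu>"
    unfolding min_singular_value_def
    by (intro Min_le finite_singular_values) (use \<mu> in \<open>simp add: singular_values_def\<close>)
  then have "min_singular_value A * norm v \<le> sqrt \<mu> * norm v"
    by (simp add: mult_right_mono)
  also have "\<dots> = sqrt (\<mu> * (norm v)\<^sup>2)"
    by (simp add: real_sqrt_mult)
  also have "\<dots> \<le> norm (A *v v)"
    using real_sqrt_le_mono[OF le] by simp
  finally show ?thesis .
qed

text \<open>Injectivity ensures that no entry is counted twice.\<close>

lemma norm_select_entries_le:
  fixes v :: "real^'m" and f :: "'k::finite \<Rightarrow> 'm"
  assumes "inj f"
  shows "norm (\<chi> i. v $ f i) \<le> norm v"
proof -
  have "(\<Sum>i\<in>UNIV. (v $ f i)\<^sup>2) = (\<Sum>j\<in>range f. (v $ j)\<^sup>2)"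
    using assms by (simp add: sum.reindex)
  also have "\<dots> \<le> (\<Sum>j\<in>UNIV. (v $ j)\<^sup>2)"
    by (rule sum_mono2) auto
  finally show ?thesis by (simp add: norm_vec_def L2_set_def)
qed

theorem theorem1:
  fixes C :: "real^'n^'m" and \<epsilon> \<sigma>\<^sub>1 :: real
    and y \<nu> :: "real^'m" and xstar xhat :: "real^'n"
    and row_sel :: "'k::finite \<Rightarrow> 'm"
    and y\<^sub>1 :: "real^'k" and C\<^sub>1 :: "real^'n^'k"
  assumes "CARD('n) \<le> CARD('m)"
    and "\<epsilon> > 0"
    and "y = C *v xstar + \<nu>"
    and "norm \<nu> \<le> \<epsilon>"
    and "CARD('k) > CARD('n)"
    and "inj row_sel"
    and "y\<^sub>1 = (\<chi> i. y $ row_sel i)"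
    and "C\<^sub>1 = (\<chi> i. C $ row_sel i)"
    and "\<sigma>\<^sub>1 = min_singular_value C\<^sub>1"
    and "is_arg_min (\<lambda>x. 1/2 * (norm (y\<^sub>1 - C\<^sub>1 *v x))\<^sup>2) (\<lambda>x. True) xhat"
  shows "ereal (norm (xhat - xstar)) \<le> 2 / ereal \<sigma>\<^sub>1 * ereal \<epsilon>"
proof -
  have "y\<^sub>1 - C\<^sub>1 *v xstar = (\<chi> i. \<nu> $ row_sel i)"
    using assms(3,7,8) by (simp add: vec_eq_iff matrix_vector_mult_def)
  then have star: "norm (y\<^sub>1 - C\<^sub>1 *v xstar) \<le> \<epsilon>"
    using norm_select_entries_le[OF assms(6), of \<nu>] assms(4) by simp
  have "(norm (y\<^sub>1 - C\<^sub>1 *v xhat))\<^sup>2 \<le> (norm (y\<^sub>1 - C\<^sub>1 *v xstar))\<^sup>2"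
    using assms(10) by (simp add: is_arg_min_linorder)
  then have hat: "norm (y\<^sub>1 - C\<^sub>1 *v xhat) \<le> \<epsilon>"
    using star power2_le_imp_le by fastforce
  have "C\<^sub>1 *v (xhat - xstar) = (y\<^sub>1 - C\<^sub>1 *v xstar) - (y\<^sub>1 - C\<^sub>1 *v xhat)"
    by (simp add: matrix_vector_mult_diff_distrib)
  then have "norm (C\<^sub>1 *v (xhat - xstar)) \<le> 2 * \<epsilon>"
    using norm_triangle_ineq4[of "y\<^sub>1 - C\<^sub>1 *v xstar" "y\<^sub>1 - C\<^sub>1 *v xhat"] star hat by simp
  then have main: "\<sigma>\<^sub>1 * norm (xhat - xstar) \<le> 2 * \<epsilon>"
    using min_singular_value_bound[of C\<^sub>1 "xhat - xstar"] assms(9) by simp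
  show ?thesis
  proof (cases "\<sigma>\<^sub>1 = 0")
    case True
    (* In the extended reals 2 / 0 is infinite, so the claim is trivial. *)
    then have "2 / ereal \<sigma>\<^sub>1 * ereal \<epsilon> = \<infinity>"
      using assms(2) by (simp add: divide_ereal_def zero_ereal_def[symmetric])
    then show ?thesis by (simp only: ereal_less_eq(1))
  next
    case False
    then have "0 < \<sigma>\<^sub>1"
      using min_singular_value_nonneg[of C\<^sub>1] assms(9) by simp
    then have "norm (xhat - xstar) \<le> 2 / \<sigma>\<^sub>1 * \<epsilon>"
      using main by (simp add: field_simps)
    moreover have "2 / ereal \<sigma>\<^sub>1 * ereal \<epsilon> = ereal (2 / \<sigma>\<^sub>1 * \<epsilon>)"
      using False by simp
    ultimately show ?thesis by simp
  qed
qed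

end
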